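(* Let $p$ be an odd prime and let $e$ be a divisor of $p-1$ such that $f=\frac{p-1}{e}$ is of the form $2^r$ with $r\geq 1$. Let $g$ be a primitive root modulo $p^2$, let $b$ be an integer with $0\le b\le pf-1$, and let $\mathbf{s}^\infty$ be the generalized cyclotomic binary sequence of period $p^2$ with characteristic set $C_1$ (defined in the context). If $2^e\not\equiv 1 \pmod{p^2}$, then \[L(\mathbf{s}^\infty)=\begin{cases} p^2-\frac{p-1}{2}, & 2\in D_0^{(p)},\\ p^2, & 2\notin D_0^{(p)}.\end{cases}\]
   Context: For $j\in\{1,2\}$ let $d_j=p^{j-1}f$, let $D_0^{(p^j)}=\{g^{d_j t}\bmod p^j : 0\le t<e\}$ and $D_i^{(p^j)}=\{g^i x \bmod p^j : x\in D_0^{(p^j)}\}$ for integers $i$; subscripts of $D^{(p^j)}$ are taken modulo $d_j$ (these classes partition $\mathbb{Z}_{p^j}^*$). For a set $D\subseteq\mathbb{Z}_p$, $pD=\{px : x\in D\}\subseteq \mathbb{Z}_{p^2}$. Define $C_1=\{0\}\cup\bigcup_{i=0}^{f/2-1} pD^{(p)}_{(i+b)\bmod f}\cup\bigcup_{i=0}^{pf/2-1} D^{(p^2)}_{(i+b)\bmod pf}\subseteq\mathbb{Z}_{p^2}$, and the binary sequence $\mathbf{s}^\infty=(s_0,s_1,\dots)$ by $s_i=1$ if $i\bmod p^2\in C_1$ and $s_i=0$ otherwise. The linear complexity $L(\mathbf{s}^\infty)$ is the length of the shortest linear feedback shift register over $\mathbb{F}_2$ generating the sequence; equivalently $p^2-\deg\gcd(x^{p^2}-1,s(x))$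 where $s(x)=\sum_{i=0}^{p^2-1}s_ix^i\in\mathbb{F}_2[x]$. *)

theory Defs
  imports "HOL-Number_Theory.Number_Theory" "HOL-Library.Z2"
begin

(* Residue classes modulo n are represented by the naturals below n.
   The natural subscript i is not reduced here: g ^ i with i < p ^ (j - 1) * f already
   gives every class, and gen_cyc_char_set reduces its subscripts explicitly. *)

definition gen_cyc_class :: "nat \<Rightarrow> nat \<Rightarrow> nat \<Rightarrow> nat \<Rightarrow> nat \<Rightarrow> nat \<Rightarrow> nat set" where
  "gen_cyc_class p e f g j i =
     (let d = p ^ (j - 1) * f; D0 = {g ^ (d * t) mod p ^ j | t. t < e}
      in {g ^ i * x mod p ^ j | x. x \<in> D0})"

definition gen_cyc_char_set :: "nat \<Rightarrow> nat \<Rightarrow> nat \<Rightarrow> nat \<Rightarrow> nat \<Rightarrow> nat set" where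
  "gen_cyc_char_set p e f g b =
     {0}
     \<union> (\<Union>i<f div 2. (\<lambda>x. p * x) ` gen_cyc_class p e f g 1 ((i + b) mod f))
     \<union> (\<Union>i<p * f div 2. gen_cyc_class p e f g 2 ((i + b) mod (p * f)))"

definition gen_cyc_seq :: "nat \<Rightarrow> nat \<Rightarrow> nat \<Rightarrow> nat \<Rightarrow> nat \<Rightarrow> nat \<Rightarrow> bit" where
  "gen_cyc_seq p e f g b n = (if n mod p\<^sup>2 \<in> gen_cyc_char_set p e f g b then 1 else 0)"

(* An L-stage register with taps c, loaded with s 0, ..., s (L - 1), outputs s.
   No tap is required to be nonzero; L = 0 generates only the zero sequence. *)

definition lfsr_generates :: "nat \<Rightarrow> (nat \<Rightarrow> 'a::field) \<Rightarrow> bool" where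
  "lfsr_generates L s \<longleftrightarrow> (\<exists>c. \<forall>n. s (n + L) = (\<Sum>k<L. c k * s (n + k)))"

(* Meaningful for ultimately periodic s; for such s some L with lfsr_generates L s exists. *)

definition linear_complexity :: "(nat \<Rightarrow> 'a::field) \<Rightarrow> nat" where
  "linear_complexity s = (LEAST L. lfsr_generates L s)"

end

theory Submission
  imports "HOL-Algebra.Algebraic_Closure_Type" Defs
begin

text \<open>Write \<open>S(z)\<close> for the sum of \<open>z\<^sup>x\<close> over the characteristic set, with \<open>z\<close> in the algebraic
  closure of \<open>GF(2)\<close>. By Blahut's theorem the linear complexity is the number of \<open>p\<^sup>2\<close>-th roots of
  unity at which \<open>S\<close> does not vanish. Multiplication by \<open>h = g\<^sup>p\<^sup>f\<^sup>/\<^sup>2\<close> exchanges the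
  nonzero part of the characteristic set with its complement, so \<open>S(z) + S(z\<^sup>h) = 1\<close> for \<open>z \<noteq> 1\<close>,
  while \<open>S(1) = 1\<close>. Frobenius turns \<open>S(z) = 0\<close> into \<open>S(z\<^sup>k) = 0\<close> for every power \<open>k\<close> of 2.

  Let \<open>u\<close> be the index of 2 to the base \<open>g\<close>. If \<open>f\<close> does not divide \<open>u\<close>, then, \<open>f\<close> being a power
  of 2, some power of 2 lies in the class of \<open>h\<close>, and \<open>S\<close> has no zero. If \<open>f\<close> divides \<open>u\<close>, then
  \<open>S\<close> takes values in \<open>{0, 1}\<close> at the \<open>p\<close>-th roots of unity, and \<open>h\<close> pairs its zeros with its
  ones: this gives \<open>(p - 1)/2\<close> zeros. A zero \<open>z\<close> of order \<open>p\<^sup>2\<close> is excluded by the hypothesis on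
  \<open>2\<^sup>e\<close>: the powers of 2 then contain all residues \<open>1 + p t\<close>, so the part of \<open>S(z)\<close> with exponents
  in any one class modulo \<open>p\<close> vanishes. For a suitable class this part is a sum over consecutive
  powers of a residue \<open>\<kappa> = 1\<close> modulo \<open>p\<close>, and subtracting from it the same identity for
  \<open>z\<^sup>\<kappa>\<close> leaves two distinct terms with sum 0.\<close>

section \<open>Linear complexity and the discrete Fourier transform\<close>

lemma sum_powers_root_of_unity:
  fixes w :: "'a::field"
  assumes "w ^ n = 1"
  shows "(\<Sum>k<n. w ^ k) = (if w = 1 then of_nat n else 0)"
  using assms by (simp add: geometric_sum)

lemma sum_periodic_shift:
  fixes F :: "nat \<Rightarrow> 'a::comm_ring_1"
  assumes "\<And>n. F (n + N) = F n"
  shows "(\<Sum>n<N. F (n + k)) = (\<Sum>n<N. F n)"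
proof (induction k)
  case (Suc k)
  have "(\<Sum>n<N. F (n + Suc k)) + F k = (\<Sum>n<N. F (n + k)) + F (N + k)"
    using sum.lessThan_Suc_shift[of "\<lambda>n. F (n + k)" N] sum.lessThan_Suc[of "\<lambda>n. F (n + k)" N]
    by (simp add: add.commute)
  with Suc assms[of k] show ?case by (simp add: add.commute)
qed simp

definition dft :: "nat \<Rightarrow> 'a::field \<Rightarrow> (nat \<Rightarrow> 'a) \<Rightarrow> nat \<Rightarrow> 'a" where
  "dft N \<alpha> s a = (\<Sum>n<N. s n * \<alpha> ^ (a * n))"

text \<open>Reindexing over a full period. This turns a linear recurrence for \<open>s\<close> into
  an algebraic equation for the inverse of \<open>\<alpha> ^ a\<close>.\<close>

lemma dft_shift:
  fixes s :: "nat \<Rightarrow> 'a::field"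
  assumes per: "\<And>n. s (n + N) = s n" and \<alpha>: "\<alpha> ^ N = 1" and \<alpha>0: "\<alpha> \<noteq> 0"
  shows "(\<Sum>n<N. s (n + k) * \<alpha> ^ (a * n)) = inverse \<alpha> ^ (a * k) * dft N \<alpha> s a"
proof -
  have eq: "s (n + k) * \<alpha> ^ (a * n) = inverse \<alpha> ^ (a * k) * (s (n + k) * \<alpha> ^ (a * (n + k)))" for n
    using \<alpha>0 by (simp add: power_add distrib_left power_inverse field_simps)
  have "\<alpha> ^ (a * (n + N)) = \<alpha> ^ (a * n)" for n
    using \<alpha> by (simp add: distrib_left power_add mult.commute[of a N] power_mult)
  then have "(\<Sum>n<N. s (n + k) * \<alpha> ^ (a * (n + k))) = dft N \<alpha> s a"
    unfolding dft_def using sum_periodic_shift[of "\<lambda>n. s n * \<alpha> ^ (a * n)" N k] per by simp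
  then show ?thesis by (simp add: eq flip: sum_distrib_left)
qed

lemma power_eq_iff_cong:
  fixes \<alpha> :: "'a::field"
  assumes prim: "\<And>n. \<alpha> ^ n = 1 \<longleftrightarrow> N dvd n" and "N > 0"
  shows "\<alpha> ^ m = \<alpha> ^ n \<longleftrightarrow> [m = n] (mod N)"
proof (induction m n rule: linorder_wlog)
  case (le m n)
  have "\<alpha> \<noteq> 0" using prim[of N] \<open>N > 0\<close> by (auto simp: power_0_left)
  moreover have "\<alpha> ^ n = \<alpha> ^ m * \<alpha> ^ (n - m)" using le by (simp flip: power_add)
  ultimately have "\<alpha> ^ m = \<alpha> ^ n \<longleftrightarrow> \<alpha> ^ (n - m) = 1" by simp
  then show ?case using le prim by (simp add: cong_altdef_nat cong_sym_eq[of m n])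
next
  case (sym m n)
  then show ?case by (metis cong_sym_eq)
qed

text \<open>Orthogonality: the inner sum over \<open>a\<close> is a geometric sum of an
  \<open>N\<close>-th root of unity and singles out \<open>m = n mod N\<close>. Keeping
  \<open>of_nat N\<close> on the left avoids a division.\<close>

lemma dft_inversion:
  fixes s :: "nat \<Rightarrow> 'a::field"
  assumes per: "\<And>n. s (n + N) = s n" and "N > 0"
    and prim: "\<And>n. \<alpha> ^ n = 1 \<longleftrightarrow> N dvd n"
  shows "of_nat N * s n = (\<Sum>a<N. dft N \<alpha> s a * inverse \<alpha> ^ (a * n))"
proof -
  have \<alpha>0: "\<alpha> \<noteq> 0" using prim[of N] \<open>N > 0\<close> by (auto simp: power_0_left)
  have \<alpha>N: "\<alpha> ^ N = 1" using prim by simp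
  have smod: "s (n mod N) = s n" for n
  proof -
    have "s (m + k * N) = s m" for m k
      by (induction k) (use per[of "m + _ * N"] in \<open>auto simp: add_ac\<close>)
    from this[of "n mod N" "n div N"] show ?thesis by simp
  qed
  have "(\<Sum>a<N. dft N \<alpha> s a * inverse \<alpha> ^ (a * n))
      = (\<Sum>m<N. s m * (\<Sum>a<N. (\<alpha> ^ m * inverse \<alpha> ^ n) ^ a))"
    unfolding dft_def sum_distrib_right sum_distrib_left
    by (subst sum.swap) (simp add: power_mult_distrib mult_ac flip: power_mult)
  also have "\<dots> = (\<Sum>m<N. if m = n mod N then of_nat N * s n else 0)"
  proof (rule sum.cong[OF refl])
    fix m assume "m \<in> {..<N}"
    have "(\<alpha> ^ m * inverse \<alpha> ^ n) ^ N = 1"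
      using prim[of "m * N"] prim[of "n * N"]
      by (simp add: power_mult_distrib power_inverse flip: power_mult)
    moreover have "\<alpha> ^ m * inverse \<alpha> ^ n = 1 \<longleftrightarrow> \<alpha> ^ m = \<alpha> ^ n"
      using \<alpha>0 by (simp add: power_inverse field_simps)
    moreover have "\<alpha> ^ m = \<alpha> ^ n \<longleftrightarrow> m = n mod N"
      using power_eq_iff_cong[OF prim \<open>N > 0\<close>] \<open>m \<in> _\<close> by (auto simp: cong_def)
    ultimately show "s m * (\<Sum>a<N. (\<alpha> ^ m * inverse \<alpha> ^ n) ^ a)
        = (if m = n mod N then of_nat N * s n else 0)"
      by (simp add: sum_powers_root_of_unity smod)
  qed
  also have "\<dots> = of_nat N * s n" using \<open>N > 0\<close> by simp
  finally show ?thesis ..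
qed

section \<open>Characteristic 2: arithmetic and Frobenius in the algebraic closure\<close>

lemma two_eq_0_bit_closure [simp]: "(2 :: bit alg_closure) = 0"
  using to_ac_numeral[of "Num.Bit0 Num.One", where 'a = bit] by simp

lemma uminus_bit_closure [simp]: "- (x :: bit alg_closure) = x"
  by (metis two_eq_0_bit_closure mult_2 mult_zero_left add_eq_0_iff)

lemma add_self_bit_closure [simp]: "x + x = (0 :: bit alg_closure)"
  by (metis two_eq_0_bit_closure mult_2 mult_zero_left)

lemma of_nat_bit_closure: "(of_nat n :: bit alg_closure) = of_bool (odd n)"
  by (induction n) auto

lemma square_add_bit_closure: "(x + y)\<^sup>2 = x\<^sup>2 + (y :: bit alg_closure)\<^sup>2"
  by (simp add: power2_sum)

lemma square_sum_bit_closure: "(\<Sum>x\<in>A. h x)\<^sup>2 = (\<Sum>x\<in>A. (h x :: bit alg_closure)\<^sup>2)"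
  by (induction A rule: infinite_finite_induct) (auto simp: square_add_bit_closure)

lemma square_eq_iff_bit_closure [simp]: "x\<^sup>2 = y\<^sup>2 \<longleftrightarrow> x = (y :: bit alg_closure)"
  using power2_eq_iff[of x y] by auto

lemma fixed_by_square_bit_closure:
  "x\<^sup>2 = x \<Longrightarrow> x = 0 \<or> x = (1 :: bit alg_closure)"
  by (simp add: power2_eq_square)

lemma coeff_linear_factors_square:
  fixes B :: "bit alg_closure set"
  shows "(coeff (\<Prod>x\<in>B. [:-x, 1:]) k)\<^sup>2 = coeff (\<Prod>x\<in>B. [:-(x\<^sup>2), 1:]) k"
proof (induction B arbitrary: k rule: infinite_finite_induct)
  case (insert x B)
  then show ?case
    by (simp add: coeff_pCons square_add_bit_closure power_mult_distrib split: nat.split)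
qed auto

text \<open>Squaring is injective on \<open>B\<close>, hence permutes it, so each coefficient equals
  its own square and is 0 or 1.\<close>

lemma coeff_linear_factors_in_range:
  fixes B :: "bit alg_closure set"
  assumes "finite B" and "\<And>x. x \<in> B \<Longrightarrow> x\<^sup>2 \<in> B"
  shows "coeff (\<Prod>x\<in>B. [:-x, 1:]) k \<in> range to_ac"
proof -
  have inj: "inj_on (\<lambda>x. x\<^sup>2) B" by (auto intro!: inj_onI)
  moreover have "(\<lambda>x. x\<^sup>2) ` B = B"
    using assms by (intro endo_inj_surj inj) auto
  ultimately have "(\<Prod>x\<in>B. [:-(x\<^sup>2), 1:]) = (\<Prod>x\<in>B. [:-x, 1:])"
    using prod.reindex[OF inj, of "\<lambda>x. [:-x, 1:]"] by (simp add: o_def)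
  then have "coeff (\<Prod>x\<in>B. [:-x, 1:]) k \<in> {0, 1}"
    using fixed_by_square_bit_closure coeff_linear_factors_square[of B k] by auto
  then show ?thesis using rangeI[of to_ac 0] rangeI[of to_ac 1] by auto
qed

text \<open>Each \<open>a\<close> in the support makes the inverse of \<open>\<alpha> ^ a\<close> a
  root of the characteristic polynomial of the register, whose degree is at most
  \<open>L\<close>.\<close>

lemma card_dft_support_le:
  fixes s :: "nat \<Rightarrow> 'a::field" and c :: "nat \<Rightarrow> 'a"
  assumes per: "\<And>n. s (n + N) = s n" and "N > 0"
    and prim: "\<And>n. \<alpha> ^ n = 1 \<longleftrightarrow> N dvd n"
    and rec: "\<And>n. s (n + L) = (\<Sum>k<L. c k * s (n + k))"
  shows "card {a. a < N \<and> dft N \<alpha> s a \<noteq> 0} \<le> L"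
proof -
  define A where "A = {a. a < N \<and> dft N \<alpha> s a \<noteq> 0}"
  define C where "C = monom 1 L - (\<Sum>k<L. monom (c k) k)"
  have \<alpha>0: "\<alpha> \<noteq> 0" using prim[of N] \<open>N > 0\<close> by (auto simp: power_0_left)
  have \<alpha>N: "\<alpha> ^ N = 1" using prim by simp
  have coeffC: "coeff C m = (if m = L then 1 else if m < L then - c m else 0)" for m
    by (auto simp: C_def coeff_sum)
  then have "C \<noteq> 0" by (metis coeff_0 zero_neq_one)
  have "degree C \<le> L" by (rule degree_le) (simp add: coeffC)
  have root: "poly C (inverse \<alpha> ^ a) = 0" if "a \<in> A" for a
  proof -
    \<comment> \<open>Transform both sides of the recurrence; the nonzero factor
      \<open>dft N \<alpha> s a\<close> then cancels.\<close>
    have "inverse \<alpha> ^ (a * L) * dft N \<alpha> s a = (\<Sum>n<N. s (n + L) * \<alpha> ^ (a * n))"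
      using dft_shift[of s, OF per \<alpha>N \<alpha>0] by simp
    also have "\<dots> = (\<Sum>k<L. c k * (\<Sum>n<N. s (n + k) * \<alpha> ^ (a * n)))"
      unfolding rec sum_distrib_right sum_distrib_left by (subst sum.swap) (simp add: mult_ac)
    also have "\<dots> = (\<Sum>k<L. c k * inverse \<alpha> ^ (a * k)) * dft N \<alpha> s a"
      using dft_shift[of s, OF per \<alpha>N \<alpha>0] by (simp add: sum_distrib_right mult.assoc)
    finally have "inverse \<alpha> ^ (a * L) = (\<Sum>k<L. c k * inverse \<alpha> ^ (a * k))"
      using that by (simp add: A_def)
    then show ?thesis by (simp add: C_def poly_sum poly_monom flip: power_mult)
  qed
  have "inj_on (\<lambda>a. inverse \<alpha> ^ a) A"
    using power_eq_iff_cong[OF prim \<open>N > 0\<close>]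
    by (auto intro!: inj_onI simp: A_def power_inverse cong_def)
  then have "card A = card ((\<lambda>a. inverse \<alpha> ^ a) ` A)" by (simp add: card_image)
  also have "\<dots> \<le> card {x. poly C x = 0}"
    using root \<open>C \<noteq> 0\<close> by (intro card_mono poly_roots_finite) auto
  also have "\<dots> \<le> degree C" by (rule card_poly_roots_bound) fact
  finally show ?thesis using \<open>degree C \<le> L\<close> by (simp add: A_def)
qed


text \<open>Over the algebraic closure the shortest register has characteristic polynomial
  \<open>\<Prod>(X - \<alpha>\<^sup>-\<^sup>a)\<close> over the support of the transform. The support is closed
  under doubling, so Frobenius fixes that polynomial and its taps are bits.\<close>

lemma linear_complexity_eq_card_dft_support:
  fixes s :: "nat \<Rightarrow> bit" and \<alpha> :: "bit alg_closure"
  assumes per: "\<And>n. s (n + N) = s n" and "odd N"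
    and prim: "\<And>n. \<alpha> ^ n = 1 \<longleftrightarrow> N dvd n"
  shows "linear_complexity s = card {a. a < N \<and> dft N \<alpha> (\<lambda>n. to_ac (s n)) a \<noteq> 0}"
proof -
  define t where "t = (\<lambda>n. to_ac (s n))"
  define A where "A = {a. a < N \<and> dft N \<alpha> t a \<noteq> 0}"
  have "N > 0" using \<open>odd N\<close> by (simp add: odd_pos)
  have pert: "t (n + N) = t n" for n by (simp add: t_def per)
  have \<alpha>0: "\<alpha> \<noteq> 0" using prim[of N] \<open>N > 0\<close> by (auto simp: power_0_left)
  have \<alpha>N: "\<alpha> ^ N = 1" using prim by simp
  \<comment> \<open>A register over bits is also one over the closure, with taps mapped by
    \<open>to_ac\<close>.\<close>
  have ge: "card A \<le> L" if gen: "lfsr_generates L s" for L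
  proof -
    obtain c where "\<forall>n. s (n + L) = (\<Sum>k<L. c k * s (n + k))"
      using gen unfolding lfsr_generates_def by blast
    then have "t (n + L) = (\<Sum>k<L. to_ac (c k) * t (n + k))" for n
      by (simp add: t_def to_ac_sum del: mult_bit_eq_and)
    then show ?thesis unfolding A_def
      by (rule card_dft_support_le[of t N \<alpha> L "\<lambda>k. to_ac (c k)", OF pert \<open>N > 0\<close> prim])
  qed
  define B where "B = (\<lambda>a. inverse \<alpha> ^ a) ` A"
  define C where "C = (\<Prod>x\<in>B. [:-x, 1:])"
  have inj: "inj_on (\<lambda>a. inverse \<alpha> ^ a) A"
    using power_eq_iff_cong[OF prim \<open>N > 0\<close>]
    by (auto intro!: inj_onI simp: A_def power_inverse cong_def)
  have finA: "finite A" by (simp add: A_def)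
  have square: "x\<^sup>2 \<in> B" if x: "x \<in> B" for x
  proof -
    obtain a where a: "a \<in> A" "x = inverse \<alpha> ^ a" using x by (auto simp: B_def)
    have modN: "\<alpha> ^ (2 * a mod N * n) = \<alpha> ^ (2 * a * n)" for n
      by (subst power_eq_iff_cong[OF prim \<open>N > 0\<close>]) (simp add: cong_def mod_simps)
    \<comment> \<open>The values of \<open>t\<close> are 0 or 1, so the square of the transform at
      \<open>a\<close> is the transform at \<open>2 * a\<close>.\<close>
    have "t n ^ 2 = t n" for n unfolding t_def by (cases "s n") auto
    then have "dft N \<alpha> t (2 * a mod N) = (dft N \<alpha> t a)\<^sup>2"
      unfolding dft_def square_sum_bit_closure power_mult_distrib modN
      by (simp add: mult_ac flip: power_mult)
    then have "2 * a mod N \<in> A" using a \<open>N > 0\<close> by (simp add: A_def)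
    moreover have "x\<^sup>2 = inverse \<alpha> ^ (2 * a mod N)"
      using modN[of 1] by (simp add: a power_inverse mult.commute flip: power_mult)
    ultimately show ?thesis by (simp add: B_def)
  qed
  have "finite B" by (simp add: B_def finA)
  have "\<exists>d. to_ac d = coeff C k" for k
    using coeff_linear_factors_in_range[OF \<open>finite B\<close> square, of k] unfolding C_def by (metis imageE)
  then obtain d where d: "\<And>k. to_ac (d k) = coeff C k" by metis
  have degC: "degree C = card A" 
    unfolding C_def by (subst degree_prod_eq_sum_degree) (auto simp: B_def card_image[OF inj])
  have lead: "coeff C (card A) = 1"
    using degC lead_coeff_prod[of "\<lambda>x. [:-x, 1:]" B] unfolding C_def by simp
  have root: "inverse \<alpha> ^ (a * card A) = (\<Sum>k<card A. coeff C k * inverse \<alpha> ^ (a * k))"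
    if "a \<in> A" for a
  proof -
    have "poly C (inverse \<alpha> ^ a) = 0"
      unfolding C_def using \<open>finite B\<close> that
      by (auto simp: poly_prod B_def intro!: bexI[of _ a])
    then have "(\<Sum>k<card A. coeff C k * inverse \<alpha> ^ (a * k)) + inverse \<alpha> ^ (a * card A) = 0"
      by (simp add: poly_altdef degC lead lessThan_Suc_atMost[symmetric] flip: power_mult)
    then show ?thesis by (metis add_eq_0_iff uminus_bit_closure)
  qed
  have inv: "t n = (\<Sum>a\<in>A. dft N \<alpha> t a * inverse \<alpha> ^ (a * n))" for n
  proof -
    have "t n = (\<Sum>a<N. dft N \<alpha> t a * inverse \<alpha> ^ (a * n))"
      using dft_inversion[of t, OF pert \<open>N > 0\<close> prim, of n] \<open>odd N\<close> by (simp add: of_nat_bit_closure)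
    also have "\<dots> = (\<Sum>a\<in>A. dft N \<alpha> t a * inverse \<alpha> ^ (a * n))"
      by (rule sum.mono_neutral_right) (auto simp: A_def)
    finally show ?thesis .
  qed
  \<comment> \<open>By inversion \<open>t\<close> is a combination of the sequences
    \<open>inverse \<alpha> ^ (a * n)\<close> with \<open>a\<close> in \<open>A\<close>, and each of
    them satisfies the recurrence given by \<open>C\<close>.\<close>
  have "to_ac (s (n + card A)) = to_ac (\<Sum>k<card A. d k * s (n + k))" for n
  proof -
    have "t (n + card A) = (\<Sum>a\<in>A. dft N \<alpha> t a * inverse \<alpha> ^ (a * n) * inverse \<alpha> ^ (a * card A))"
      by (simp add: inv distrib_left power_add mult.assoc)
    also have "\<dots> = (\<Sum>a\<in>A. \<Sum>k<card A. coeff C k * (dft N \<alpha> t a * inverse \<alpha> ^ (a * (n + k))))"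
      by (intro sum.cong refl) (simp add: root sum_distrib_left distrib_left power_add mult_ac)
    also have "\<dots> = (\<Sum>k<card A. coeff C k * t (n + k))"
      by (subst sum.swap) (simp add: inv sum_distrib_left)
    also have "\<dots> = to_ac (\<Sum>k<card A. d k * s (n + k))"
      by (simp add: to_ac_sum d t_def del: mult_bit_eq_and)
    finally show ?thesis by (simp add: t_def)
  qed
  then have "lfsr_generates (card A) s"
    unfolding lfsr_generates_def to_ac_eq_iff by blast
  then show ?thesis
    unfolding linear_complexity_def A_def[symmetric] t_def[symmetric]
    using ge by (rule Least_equality)
qed

section \<open>Roots of unity\<close>

lemma power_mod_root:
  fixes z :: "'a::monoid_mult"
  assumes "z ^ n = 1"
  shows "z ^ (k mod n) = z ^ k"
  using assms power_add[of z "n * (k div n)" "k mod n"] by (simp add: power_mult)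

lemma power_cong_root:
  fixes z :: "'a::monoid_mult"
  assumes "z ^ n = 1" and "[k = l] (mod n)"
  shows "z ^ k = z ^ l"
  using power_mod_root[OF assms(1), of k] power_mod_root[OF assms(1), of l] assms(2)
  by (simp add: cong_def)

text \<open>By Bezout, \<open>z\<close> raised to the gcd of \<open>p\<^sup>2\<close> and
  \<open>n\<close> is 1. That gcd is 1, \<open>p\<close> or \<open>p\<^sup>2\<close>, and
  \<open>z ^ p \<noteq> 1\<close> leaves only the last.\<close>

lemma prime_square_order:
  fixes z :: "'a::field"
  assumes "prime p" and z: "z ^ p\<^sup>2 = 1" and "z ^ p \<noteq> 1"
  shows "z ^ n = 1 \<longleftrightarrow> p\<^sup>2 dvd n"
proof
  assume n: "z ^ n = 1"
  have "p\<^sup>2 \<noteq> 0" using assms(1) by auto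
  then obtain x y where xy: "p\<^sup>2 * x = n * y + gcd (p\<^sup>2) n"
    using bezout_nat by blast
  have "1 = z ^ (n * y) * z ^ gcd (p\<^sup>2) n"
    using z unfolding power_add[symmetric] xy[symmetric] by (simp add: power_mult)
  then have gcd1: "z ^ gcd (p\<^sup>2) n = 1" using n by (simp add: power_mult)
  obtain i where i: "i \<le> 2" "gcd (p\<^sup>2) n = p ^ i"
    using divides_primepow_nat[OF assms(1)] gcd_dvd1 by blast
  have "i \<noteq> 0" "i \<noteq> 1" using gcd1 i(2) assms(3) by (auto intro: ccontr)
  then have "i = 2" using i(1) by linarith
  then show "p\<^sup>2 dvd n" using i(2) by (metis gcd_dvd2)
qed (use z in \<open>auto simp: power_mult\<close>)

lemma primitive_prime_square_root_exists:
  assumes "prime p" and "odd p"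
  shows "\<exists>\<alpha> :: bit alg_closure. \<forall>n. \<alpha> ^ n = 1 \<longleftrightarrow> p\<^sup>2 dvd n"
proof -
  have "p - 1 > 0" "p > 0" using prime_gt_1_nat[OF assms(1)] by auto
  then obtain \<beta> :: "bit alg_closure" where "(\<Sum>k\<le>p - 1. 1 * \<beta> ^ k) = 0"
    using alg_closed[of "p - 1" "\<lambda>_. 1 :: bit alg_closure"] by auto
  then have sum0: "(\<Sum>k<p. \<beta> ^ k) = 0"
    using \<open>p > 0\<close> by (simp add: lessThan_Suc_atMost[symmetric])
  have "\<beta> ^ p - 1 = (\<beta> - 1) * (\<Sum>k<p. \<beta> ^ k)" by (rule power_diff_1_eq)
  then have \<beta>p: "\<beta> ^ p = 1" using sum0 by simp
  \<comment> \<open>At 1 the sum of powers would be \<open>p\<close>, which is odd and hence 1 in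
    characteristic 2.\<close>
  have "\<beta> \<noteq> 1" using sum0 \<open>odd p\<close> by (auto simp: of_nat_bit_closure)
  obtain \<alpha> where \<alpha>: "\<alpha> ^ p = \<beta>" using nth_root_exists[OF \<open>p > 0\<close>] by blast
  have "\<alpha> ^ p\<^sup>2 = 1" using \<beta>p by (simp add: power2_eq_square power_mult \<alpha>)
  then show ?thesis
    using prime_square_order[OF assms(1), of \<alpha>] \<alpha> \<open>\<beta> \<noteq> 1\<close> by blast
qed

section \<open>Elementary congruences\<close>

lemma cong_lift_multiple:
  fixes n i m e :: nat
  assumes "[n = i] (mod m)" and "e > 0"
  shows "\<exists>t<e. [n = i + m * t] (mod m * e)"
proof -
  have "\<exists>q1 q2. i + q1 * m = n + q2 * m"
    using assms(1) by (simp only: cong_iff_lin_nat)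
  then obtain q1 q2 where q: "i + q1 * m = n + q2 * m" by blast
  \<comment> \<open>The difference of \<open>n\<close> and \<open>i\<close> is
    \<open>m * (q1 - q2)\<close>; the factor \<open>e - 1\<close> stands for -1 modulo
    \<open>e\<close>.\<close>
  define t where "t = (q1 + (e - 1) * q2) mod e"
  have "[m * t = m * (q1 + (e - 1) * q2)] (mod m * e)"
    by (simp only: t_def cong_def mult_mod_right mod_mod_trivial)
  then have "[i + m * t = i + m * (q1 + (e - 1) * q2)] (mod m * e)"
    by (rule cong_add[OF cong_refl])
  also have "i + m * (q1 + (e - 1) * q2) = n + q2 * (m * e)"
    using q \<open>e > 0\<close> by (cases e) (auto simp: algebra_simps)
  also have "[n + q2 * (m * e) = n] (mod m * e)"
    by (simp add: cong_def)
  finally show ?thesis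
    using \<open>e > 0\<close> by (intro exI[of _ t]) (simp add: t_def cong_sym)
qed

text \<open>In the binomial expansion every term after the linear one is divisible by
  \<open>p\<^sup>2\<close>.\<close>

lemma power_one_plus_prime_mult:
  fixes p k t :: nat
  shows "[(1 + p * k) ^ t = 1 + p * k * t] (mod p\<^sup>2)"
proof (induction t)
  case (Suc t)
  have "[(1 + p * k) ^ Suc t = (1 + p * k) * (1 + p * k * t)] (mod p\<^sup>2)"
    unfolding power_Suc by (rule cong_scalar_left[OF Suc])
  also have "(1 + p * k) * (1 + p * k * t) = 1 + p * k * Suc t + p\<^sup>2 * (k * k * t)"
    by (simp add: algebra_simps power2_eq_square)
  also have "[\<dots> = 1 + p * k * Suc t] (mod p\<^sup>2)"
    by (simp add: cong_def)
  finally show ?case .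
qed simp

section \<open>Index arithmetic of the characteristic set\<close>

locale gen_cyclotomic =
  fixes p e f g b :: nat
  assumes prime_p: "prime p" and odd_p: "odd p"
    and ef: "e * f = p - 1" and even_f: "even f"
    and primroot: "residue_primroot (p\<^sup>2) g"
begin

abbreviation "C \<equiv> gen_cyc_char_set p e f g b"

text \<open>The residue of the index \<open>n\<close> modulo \<open>m\<close> lies in the half \<open>b, \<dots>, b + m/2 - 1\<close> from which the
  characteristic set takes its classes. The integers avoid truncated subtraction.\<close>

definition low :: "nat \<Rightarrow> nat \<Rightarrow> bool" where
  "low m n \<longleftrightarrow> (int n - int b) mod int m < int m div 2"

lemma p_ge_3: "p \<ge> 3"
  using prime_ge_2_nat[OF prime_p] odd_p by (cases "p = 2") auto

lemma e_pos: "e > 0" and f_pos: "f > 0"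
  using ef p_ge_3 by (auto intro: Nat.gr0I)

lemma pf_e: "p * f * e = p * (p - 1)"
  using ef by (simp add: mult_ac)

lemma coprime_g: "coprime (p\<^sup>2) g" "coprime p g"
  using primroot by (auto simp: residue_primroot_def)

lemma cong_power_iff: "[g ^ m = g ^ n] (mod p\<^sup>2) \<longleftrightarrow> [m = n] (mod p * (p - 1))"
proof -
  have "ord (p\<^sup>2) g = p * (p - 1)"
    using primroot totient_prime_power[OF prime_p, of 2] by (simp add: residue_primroot_def)
  then show ?thesis using order_divides_expdiff[OF coprime_g(1)] by simp
qed

text \<open>A primitive root modulo \<open>p\<^sup>2\<close> is one modulo \<open>p\<close>: if
  \<open>d\<close> is the order modulo \<open>p\<close>, then \<open>g ^ d = 1 + p * k\<close> makes
  \<open>g ^ (d * p)\<close> congruent to 1 modulo \<open>p\<^sup>2\<close>, so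
  \<open>p * (p - 1)\<close> divides \<open>d * p\<close>.\<close>

lemma cong_power_prime_iff: "[g ^ m = g ^ n] (mod p) \<longleftrightarrow> [m = n] (mod (p - 1))"
proof -
  define d where "d = ord p g"
  have "d dvd p - 1"
    unfolding d_def using coprime_g(2) totient_prime[OF prime_p] order_divides_totient by metis
  moreover have "p - 1 dvd d"
  proof -
    have "[g ^ d = 1] (mod p)" unfolding d_def by (simp only: ord_divides dvd_refl)
    moreover have "g ^ d \<ge> 1" using coprime_g(2) p_ge_3 by (cases "g = 0") auto
    moreover obtain k where "g ^ d - 1 = p * k"
      using cong_to_1_nat[OF \<open>[g ^ d = 1] (mod p)\<close>] by (elim dvdE)
    ultimately have k: "g ^ d = 1 + p * k" by simp
    have "[(g ^ d) ^ p = 1 + p * k * p] (mod p\<^sup>2)"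
      unfolding k by (rule power_one_plus_prime_mult)
    also have "1 + p * k * p = 1 + k * p\<^sup>2"
      by (simp add: power2_eq_square)
    also have "[1 + k * p\<^sup>2 = 1] (mod p\<^sup>2)"
      unfolding cong_def by (rule mod_mult_self1)
    finally have "[g ^ (d * p) = g ^ 0] (mod p\<^sup>2)" by (simp add: power_mult)
    then have "p * (p - 1) dvd d * p" unfolding cong_power_iff by (simp add: cong_0_iff)
    then show ?thesis using p_ge_3 by (simp add: mult.commute)
  qed
  ultimately have "d = p - 1" by (rule dvd_antisym)
  then show ?thesis using order_divides_expdiff[OF coprime_g(2)] by (simp add: d_def)
qed

lemma cong_power_ex:
  assumes "coprime x p"
  shows "\<exists>n. [x = g ^ n] (mod p\<^sup>2)"
proof -
  have "x mod p\<^sup>2 \<in> totatives (p\<^sup>2)"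
  proof -
    have "\<not> p dvd x" using assms prime_p by (metis coprime_absorb_right not_prime_unit)
    then have "x mod p\<^sup>2 \<noteq> 0"
      by (metis dvd_triv_left dvd_trans mod_0_imp_dvd power2_eq_square)
    moreover have "coprime (x mod p\<^sup>2) (p\<^sup>2)"
      using assms p_ge_3 by (subst coprime_mod_left_iff) auto
    ultimately show ?thesis
      using p_ge_3 by (simp add: totatives_def less_imp_le)
  qed
  moreover have "p\<^sup>2 > 1" using p_ge_3 by (intro one_less_power) auto
  ultimately have "x mod p\<^sup>2 \<in> (\<lambda>i. g ^ i mod p\<^sup>2) ` {..<totient (p\<^sup>2)}"
    using bij_betw_imp_surj_on[OF residue_primroot_is_generator[OF _ primroot]] by simp
  then obtain n where "x mod p\<^sup>2 = g ^ n mod p\<^sup>2" by blast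
  then show ?thesis by (auto simp: cong_def)
qed

text \<open>The class consists of the powers with exponents \<open>i + d * t\<close>,
  \<open>t < e\<close>. If \<open>g\<close> has order \<open>d * e\<close>, these exhaust the
  exponents congruent to \<open>i\<close> modulo \<open>d\<close>. Taking the order as a hypothesis
  serves both levels \<open>j = 1\<close> and \<open>j = 2\<close>.\<close>

lemma gen_cyc_class_mem_iff:
  assumes pow: "\<And>m n. [g ^ m = g ^ n] (mod p ^ j) \<longleftrightarrow> [m = n] (mod p ^ (j - 1) * f * e)"
  shows "g ^ n mod p ^ j \<in> gen_cyc_class p e f g j i \<longleftrightarrow> [n = i] (mod p ^ (j - 1) * f)"
proof -
  define d where "d = p ^ (j - 1) * f"
  have "gen_cyc_class p e f g j i = (\<lambda>x. g ^ i * x mod p ^ j) ` (\<lambda>t. g ^ (d * t) mod p ^ j) ` {..<e}"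
    unfolding gen_cyc_class_def Let_def d_def by blast
  also have "\<dots> = (\<lambda>t. g ^ (i + d * t) mod p ^ j) ` {..<e}"
    by (simp add: image_image power_add mod_simps)
  finally have "g ^ n mod p ^ j \<in> gen_cyc_class p e f g j i
      \<longleftrightarrow> (\<exists>t<e. [g ^ n = g ^ (i + d * t)] (mod p ^ j))"
    by (auto simp: cong_def)
  also have "\<dots> \<longleftrightarrow> (\<exists>t<e. [n = i + d * t] (mod d * e))"
    by (simp only: pow d_def)
  also have "\<dots> \<longleftrightarrow> [n = i] (mod d)"
  proof
    assume "\<exists>t<e. [n = i + d * t] (mod d * e)"
    then obtain t where "[n = i + d * t] (mod d)"
      using cong_dvd_modulus_nat dvd_triv_left by blast
    then show "[n = i] (mod d)" by (simp add: cong_def)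
  next
    assume "[n = i] (mod d)"
    then show "\<exists>t<e. [n = i + d * t] (mod d * e)" by (rule cong_lift_multiple[OF _ e_pos])
  qed
  finally show ?thesis by (simp add: d_def)
qed

lemma class_2_mem_iff: "g ^ n mod p\<^sup>2 \<in> gen_cyc_class p e f g 2 i \<longleftrightarrow> [n = i] (mod p * f)"
proof -
  have "[g ^ k = g ^ l] (mod p ^ 2) \<longleftrightarrow> [k = l] (mod p ^ (2 - 1) * f * e)" for k l
    by (simp add: cong_power_iff pf_e)
  from gen_cyc_class_mem_iff[of 2, OF this] show ?thesis by simp
qed

lemma class_1_mem_iff: "g ^ n mod p \<in> gen_cyc_class p e f g 1 i \<longleftrightarrow> [n = i] (mod f)"
proof -
  have "[g ^ k = g ^ l] (mod p ^ 1) \<longleftrightarrow> [k = l] (mod p ^ (1 - 1) * f * e)" for k l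
    using ef by (simp add: cong_power_prime_iff mult.commute[of f])
  from gen_cyc_class_mem_iff[of 1, OF this] show ?thesis by simp
qed

lemma class_is_power:
  assumes "x \<in> gen_cyc_class p e f g j i"
  shows "\<exists>n. x = g ^ n mod p ^ j"
proof -
  obtain t where "x = g ^ i * (g ^ (p ^ (j - 1) * f * t) mod p ^ j) mod p ^ j"
    using assms unfolding gen_cyc_class_def Let_def by blast
  then have "x = g ^ (i + p ^ (j - 1) * f * t) mod p ^ j"
    by (simp only: power_add mod_mult_right_eq)
  then show ?thesis by blast
qed

lemma not_p_dvd_power: "\<not> p dvd g ^ n"
proof
  assume "p dvd g ^ n"
  then have "p dvd g" by (rule prime_dvd_power[OF prime_p])
  then have "is_unit p" using coprime_common_divisor[OF coprime_g(2)] by simp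
  then show False using p_ge_3 by simp
qed

lemma not_p_dvd_power_mod: "\<not> p dvd g ^ n mod p\<^sup>2" "g ^ n mod p \<noteq> 0"
  using not_p_dvd_power[of n] by (auto simp: dvd_mod_iff power2_eq_square dvd_eq_mod_eq_0 mod_mod_cancel)

lemma low_iff:
  assumes "m > 0"
  shows "low m n \<longleftrightarrow> (\<exists>i<m div 2. [n = i + b] (mod m))"
proof
  assume *: "low m n"
  define i where "i = nat ((int n - int b) mod int m)"
  have i: "int i = (int n - int b) mod int m" using assms by (simp add: i_def)
  have "[int i + int b = int n - int b + int b] (mod int m)"
    unfolding i by (intro cong_add cong_refl) (simp add: cong_def)
  then have "[n = i + b] (mod m)" by (simp add: cong_sym flip: cong_int_iff)
  moreover have "i < m div 2" using * i unfolding low_def by linarith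
  ultimately show "\<exists>i<m div 2. [n = i + b] (mod m)" by blast
next
  assume "\<exists>i<m div 2. [n = i + b] (mod m)"
  then obtain i where i: "i < m div 2" "[int n = int i + int b] (mod int m)"
    by (metis cong_int_iff of_nat_add)
  have "[int n - int b = int i + int b - int b] (mod int m)"
    by (intro cong_diff i cong_refl)
  then have "(int n - int b) mod int m = int i"
    using i(1) by (simp add: cong_def)
  then show "low m n" unfolding low_def using i(1) by linarith
qed

lemma power_mem_iff: "g ^ n mod p\<^sup>2 \<in> C \<longleftrightarrow> low (p * f) n"
proof -
  have "g ^ n mod p\<^sup>2 \<noteq> 0" "g ^ n mod p\<^sup>2 \<noteq> p * x" for x
    using not_p_dvd_power_mod(1)[of n] by (metis dvd_0_right, metis dvd_triv_left)
  then have "g ^ n mod p\<^sup>2 \<in> C \<longleftrightarrow> (\<exists>i<p * f div 2. [n = (i + b) mod (p * f)] (mod p * f))"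
    by (auto simp: gen_cyc_char_set_def class_2_mem_iff)
  also have "\<dots> \<longleftrightarrow> low (p * f) n"
    using low_iff[of "p * f" n] p_ge_3 f_pos by (simp add: cong_def)
  finally show ?thesis .
qed

lemma p_times_power_mem_iff: "p * (g ^ n mod p) \<in> C \<longleftrightarrow> low f n"
proof -
  have "p * (g ^ n mod p) \<noteq> 0" using not_p_dvd_power_mod(2) p_ge_3 by simp
  moreover have "p * (g ^ n mod p) \<notin> gen_cyc_class p e f g 2 i" for i
    using class_is_power[of "p * (g ^ n mod p)" 2 i] not_p_dvd_power_mod(1) by (metis dvd_triv_left)
  moreover have "p * (g ^ n mod p) \<in> (*) p ` A \<longleftrightarrow> g ^ n mod p \<in> A" for A
    using p_ge_3 by auto
  ultimately have "p * (g ^ n mod p) \<in> C \<longleftrightarrow> (\<exists>i<f div 2. [n = (i + b) mod f] (mod f))"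
    by (auto simp: gen_cyc_char_set_def class_1_mem_iff[unfolded One_nat_def])
  also have "\<dots> \<longleftrightarrow> low f n"
    using low_iff[OF f_pos, of n] by (simp add: cong_def)
  finally show ?thesis .
qed

lemma low_cong: "[k = l] (mod m) \<Longrightarrow> low m k \<longleftrightarrow> low m l"
  unfolding low_def by (metis cong_def cong_diff cong_int_iff cong_refl)

text \<open>On a cycle of length \<open>m\<close>, a shift by \<open>m div 2\<close> exchanges the
  half starting at \<open>b\<close> with the other half.\<close>

lemma low_half_shift:
  assumes "even m" "m > 0"
  shows "low m (m div 2 + n) \<longleftrightarrow> \<not> low m n"
proof -
  obtain h where m: "m = 2 * h" using assms by auto
  define x where "x = int n - int b"
  define y where "y = x mod (2 * int h)"
  have "0 \<le> y" "y < 2 * int h" using assms m by (auto simp: y_def)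
  moreover have "(int h + x) mod (2 * int h) = (int h + y) mod (2 * int h)"
    by (simp add: y_def mod_simps)
  moreover have "(int h + y) mod (2 * int h) = (if y < int h then int h + y else y - int h)"
  proof (cases "y < int h")
    case False
    then have "(int h + y) mod (2 * int h) = (y - int h + 2 * int h) mod (2 * int h)" by simp
    also have "\<dots> = y - int h" using False \<open>y < 2 * int h\<close> by (subst mod_add_self2) simp
    finally show ?thesis using False by simp
  qed (use \<open>0 \<le> y\<close> in simp)
  ultimately show ?thesis
    unfolding low_def by (simp add: m add_diff_eq[symmetric] flip: x_def y_def)
qed

lemma C_less: "C \<subseteq> {..<p\<^sup>2}"
proof
  fix x assume x: "x \<in> C"
  have "p * y < p\<^sup>2" if "y \<in> gen_cyc_class p e f g 1 i" for y i
    using class_is_power[OF that] p_ge_3 by (auto simp: power2_eq_square)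
  moreover have "y < p\<^sup>2" if "y \<in> gen_cyc_class p e f g 2 i" for y i
    using class_is_power[OF that] p_ge_3 by auto
  ultimately show "x \<in> {..<p\<^sup>2}"
    using x p_ge_3 by (auto simp: gen_cyc_char_set_def)
qed

lemma finite_C: "finite C"
  using C_less finite_subset by blast

text \<open>A nonzero residue is a unit or \<open>p\<close> times a unit modulo \<open>p\<close>.
  Both kinds are indexed by exponents of \<open>g\<close>, which reduces membership in
  \<open>C\<close> to \<open>low\<close>.\<close>

lemma residue_cases:
  assumes "x < p\<^sup>2" "x \<noteq> 0"
  obtains (unit) n where "x = g ^ n mod p\<^sup>2" | (multiple) n where "x = p * (g ^ n mod p)"
proof (cases "p dvd x")
  case True
  then obtain y where y: "x = p * y" by auto
  then have "y < p" "y \<noteq> 0" using assms by (auto simp: power2_eq_square)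
  then have "coprime y p" using prime_p
    by (metis coprime_commute nat_dvd_not_less neq0_conv prime_imp_coprime_nat)
  then obtain n where "[y = g ^ n] (mod p\<^sup>2)" using cong_power_ex by blast
  then have "[y = g ^ n] (mod p)" by (rule cong_dvd_modulus_nat) simp
  then have "y = g ^ n mod p" using \<open>y < p\<close> by (simp add: cong_def)
  then show ?thesis using multiple y by blast
next
  case False
  then have "coprime x p" using prime_p by (metis coprime_commute prime_imp_coprime_nat)
  then obtain n where "[x = g ^ n] (mod p\<^sup>2)" using cong_power_ex by blast
  then show ?thesis using unit assms(1) by (simp add: cong_def)
qed

section \<open>Multiplication by powers of \<open>g\<close> and the characteristic set\<close>

lemma mult_power_unit: "g ^ k * (g ^ n mod p\<^sup>2) mod p\<^sup>2 = g ^ (k + n) mod p\<^sup>2"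
  by (simp add: power_add mod_simps)

lemma mult_power_multiple: "g ^ k * (p * (g ^ n mod p)) mod p\<^sup>2 = p * (g ^ (k + n) mod p)"
proof -
  have "g ^ k * (p * (g ^ n mod p)) mod p\<^sup>2 = p * (g ^ k * (g ^ n mod p)) mod (p * p)"
    by (simp add: power2_eq_square mult_ac)
  also have "\<dots> = p * (g ^ (k + n) mod p)"
    by (simp add: mod_mult_mult1 power_add mod_simps)
  finally show ?thesis .
qed

text \<open>As \<open>p\<close> is odd, \<open>p * f div 2\<close> is \<open>f div 2\<close> plus
  (p-1)/2 copies of \<open>f\<close>. So one multiplier is a half turn at both levels.\<close>

lemma half_pf_cong: "[p * f div 2 = f div 2] (mod f)"
proof -
  obtain h where f: "f = 2 * h" using even_f by auto
  obtain q where p: "p = 2 * q + 1" using odd_p by (metis oddE)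
  have "p * f div 2 = f * q + f div 2" by (simp add: f p algebra_simps)
  then show ?thesis by (simp add: cong_def)
qed

lemma mem_half_turn_iff:
  assumes "x < p\<^sup>2" "x \<noteq> 0"
  shows "g ^ (p * f div 2) * x mod p\<^sup>2 \<in> C \<longleftrightarrow> x \<notin> C"
  using assms
proof (cases rule: residue_cases)
  case (unit n)
  then show ?thesis
    using low_half_shift[of "p * f" n] even_f f_pos p_ge_3
    by (simp add: mult_power_unit power_mem_iff)
next
  case (multiple n)
  have "low f (p * f div 2 + n) \<longleftrightarrow> low f (f div 2 + n)"
    by (intro low_cong cong_add half_pf_cong cong_refl)
  with multiple show ?thesis
    using low_half_shift[of f n] even_f f_pos
    by (simp add: mult_power_multiple p_times_power_mem_iff)
qed

lemma mem_invariant_iff: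
  assumes "x < p\<^sup>2" and k: "[k = 0] (mod p * f)"
  shows "g ^ k * x mod p\<^sup>2 \<in> C \<longleftrightarrow> x \<in> C"
proof (cases "x = 0")
  case False
  with assms(1) show ?thesis
  proof (cases rule: residue_cases)
    case (unit n)
    have "low (p * f) (k + n) \<longleftrightarrow> low (p * f) (0 + n)"
      by (intro low_cong cong_add k cong_refl)
    with unit show ?thesis by (simp add: mult_power_unit power_mem_iff)
  next
    case (multiple n)
    have "[k = 0] (mod f)" using k by (rule cong_dvd_modulus_nat) simp
    then have "low f (k + n) \<longleftrightarrow> low f (0 + n)"
      by (intro low_cong cong_add cong_refl)
    with multiple show ?thesis by (simp add: mult_power_multiple p_times_power_mem_iff)
  qed
qed simp

lemma bij_mult_power: "bij_betw (\<lambda>x. g ^ k * x mod p\<^sup>2) {..<p\<^sup>2} {..<p\<^sup>2}"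
proof -
  have "inj_on (\<lambda>x. g ^ k * x mod p\<^sup>2) {..<p\<^sup>2}"
  proof (rule inj_onI)
    fix x y assume *: "x \<in> {..<p\<^sup>2}" "y \<in> {..<p\<^sup>2}"
      and "g ^ k * x mod p\<^sup>2 = g ^ k * y mod p\<^sup>2"
    then have "[g ^ k * x = g ^ k * y] (mod p\<^sup>2)" by (simp add: cong_def)
    then have "[x = y] (mod p\<^sup>2)"
      using coprime_g by (subst (asm) cong_mult_lcancel_nat) (auto simp: coprime_commute)
    with * show "x = y" by (simp add: cong_def)
  qed
  moreover have "(\<lambda>x. g ^ k * x mod p\<^sup>2) ` {..<p\<^sup>2} \<subseteq> {..<p\<^sup>2}"
    using p_ge_3 by auto
  ultimately show ?thesis
    by (simp add: bij_betw_def endo_inj_surj)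
qed

lemma zero_mem_C: "0 \<in> C"
  by (simp add: gen_cyc_char_set_def)

lemma bij_invariant:
  assumes "[k = 0] (mod p * f)"
  shows "bij_betw (\<lambda>x. g ^ k * x mod p\<^sup>2) C C"
proof -
  have "inj_on (\<lambda>x. g ^ k * x mod p\<^sup>2) C"
    using bij_mult_power C_less by (meson bij_betw_def inj_on_subset)
  moreover have "(\<lambda>x. g ^ k * x mod p\<^sup>2) ` C \<subseteq> C"
    using mem_invariant_iff[OF _ assms] C_less by auto
  ultimately show ?thesis by (simp add: bij_betw_def endo_inj_surj finite_C)
qed

lemma bij_half_turn:
  "bij_betw (\<lambda>x. g ^ (p * f div 2) * x mod p\<^sup>2) (C - {0}) ({..<p\<^sup>2} - C)" (is "bij_betw ?h _ _")
proof -
  have inj: "inj_on ?h {..<p\<^sup>2}" and surj: "?h ` {..<p\<^sup>2} = {..<p\<^sup>2}"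
    using bij_mult_power by (auto simp: bij_betw_def)
  have "?h ` (C - {0}) = {..<p\<^sup>2} - C"
  proof (rule subset_antisym; rule subsetI)
    fix y assume "y \<in> ?h ` (C - {0})"
    then show "y \<in> {..<p\<^sup>2} - C" using mem_half_turn_iff C_less p_ge_3 by auto
  next
    fix y assume y: "y \<in> {..<p\<^sup>2} - C"
    then have "y \<in> ?h ` {..<p\<^sup>2}" by (simp only: surj Diff_iff)
    then obtain x where x: "x < p\<^sup>2" "y = ?h x" by blast
    have "y \<notin> C" using y by simp
    then have "?h x \<notin> C" unfolding x(2) .
    moreover from this have "x \<noteq> 0" using zero_mem_C by (intro notI) simp
    ultimately have "x \<in> C - {0}" using mem_half_turn_iff[OF x(1)] by blast
    then show "y \<in> ?h ` (C - {0})" unfolding x(2) by (rule imageI)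
  qed
  moreover have "inj_on ?h (C - {0})" using inj_on_subset[OF inj] C_less by blast
  ultimately show ?thesis by (simp add: bij_betw_def)
qed

text \<open>The half turn gives \<open>2 * (card C - 1) + 1 = p\<^sup>2\<close>, and (p^2 - 1)/2 is
  even for odd \<open>p\<close>.\<close>

lemma odd_card_C: "odd (card C)"
proof -
  have C0: "card C = Suc (card (C - {0}))"
    using zero_mem_C finite_C by (metis card.remove)
  have "card (C - {0}) = p\<^sup>2 - card C"
    using bij_betw_same_card[OF bij_half_turn] C_less by (simp add: card_Diff_subset finite_C)
  moreover have "card C \<le> p\<^sup>2" using card_mono[OF _ C_less] by simp
  ultimately have "2 * card (C - {0}) + 1 = p\<^sup>2" using C0 by simp
  moreover obtain q where "p = 2 * q + 1" using odd_p by (metis oddE)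
  ultimately have "card (C - {0}) = 2 * (q * q + q)" by (simp add: power2_eq_square algebra_simps)
  then show ?thesis using C0 by simp
qed

section \<open>The values at the roots of unity\<close>

definition S :: "bit alg_closure \<Rightarrow> bit alg_closure" where
  "S z = (\<Sum>x\<in>C. z ^ x)"

lemma S_one: "S 1 = 1"
  using odd_card_C by (simp add: S_def of_nat_bit_closure)

lemma S_square: "(S z)\<^sup>2 = S (z\<^sup>2)"
  by (simp add: S_def square_sum_bit_closure power_mult[symmetric] mult.commute)

lemma S_zero_power_two: "S z = 0 \<Longrightarrow> S (z ^ 2 ^ m) = 0"
proof (induction m)
  case (Suc m)
  have "S (z ^ 2 ^ Suc m) = (S (z ^ 2 ^ m))\<^sup>2"
    unfolding S_square by (simp add: mult.commute flip: power_mult)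
  then show ?case using Suc by simp
qed simp

lemma S_invariant:
  assumes z: "z ^ p\<^sup>2 = 1" and "[k = 0] (mod p * f)"
  shows "S (z ^ g ^ k) = S z"
proof -
  have "S (z ^ g ^ k) = (\<Sum>x\<in>C. z ^ (g ^ k * x mod p\<^sup>2))"
    unfolding S_def by (simp only: power_mod_root[OF z] power_mult)
  also have "\<dots> = S z"
    unfolding S_def by (rule sum.reindex_bij_betw[OF bij_invariant[OF assms(2)]])
  finally show ?thesis .
qed

lemma S_cong:
  assumes z: "z ^ p\<^sup>2 = 1" and "[k = l] (mod p * f)"
  shows "S (z ^ g ^ k) = S (z ^ g ^ l)"
  using assms(2)
proof (induction k l rule: linorder_wlog)
  case (le k l)
  have "(z ^ g ^ k) ^ p\<^sup>2 = 1"
    using z by (metis power_commuting_commutes power_commutes power_mult mult.commute power_one)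
  moreover have "[l - k = 0] (mod p * f)"
    using le by (simp add: cong_0_iff cong_altdef_nat cong_sym_eq[of k l])
  ultimately have "S ((z ^ g ^ k) ^ g ^ (l - k)) = S (z ^ g ^ k)" by (rule S_invariant)
  then show ?case using le(1) by (simp flip: power_mult power_add)
next
  case (sym k l)
  then show ?case by (simp add: cong_sym)
qed

text \<open>In the second sum the exponent 0 gives 1 and the others run over the complement of
  \<open>C\<close>. With the first sum they cover every exponent once, and the sum of all powers of
  \<open>z\<close> vanishes.\<close>

lemma S_half_turn:
  assumes z: "z ^ p\<^sup>2 = 1" and "z \<noteq> 1"
  shows "S z + S (z ^ g ^ (p * f div 2)) = 1"
proof -
  let ?h = "g ^ (p * f div 2)"
  have "S (z ^ ?h) = 1 + (\<Sum>x\<in>C - {0}. z ^ (?h * x))"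
    unfolding S_def power_mult[symmetric] sum.remove[OF finite_C zero_mem_C] by simp
  also have "(\<Sum>x\<in>C - {0}. z ^ (?h * x)) = (\<Sum>x\<in>C - {0}. z ^ (?h * x mod p\<^sup>2))"
    by (simp only: power_mod_root[OF z])
  also have "\<dots> = (\<Sum>x\<in>{..<p\<^sup>2} - C. z ^ x)"
    by (rule sum.reindex_bij_betw[OF bij_half_turn])
  finally have "S z + S (z ^ ?h) = 1 + ((\<Sum>x\<in>{..<p\<^sup>2} - C. z ^ x) + S z)"
    by (simp add: ac_simps)
  also have "(\<Sum>x\<in>{..<p\<^sup>2} - C. z ^ x) + S z = (\<Sum>x<p\<^sup>2. z ^ x)"
    unfolding S_def using sum.subset_diff[OF C_less, of "\<lambda>x. z ^ x"] by simp
  also have "\<dots> = 0" using sum_powers_root_of_unity[OF z] assms(2) by simp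
  finally show ?thesis by simp
qed

text \<open>By the choice of \<open>m\<close>, raising to the power \<open>2 ^ m\<close> acts on
  \<open>S\<close> as the half turn, so Frobenius would make both terms of
  \<open>S_half_turn\<close> vanish.\<close>

lemma S_nonzero_half_turn:
  assumes z: "z ^ p\<^sup>2 = 1" and "z \<noteq> 1" and u: "[2 = g ^ u] (mod p\<^sup>2)"
    and m: "[m * u = p * f div 2] (mod p * f)"
  shows "S z \<noteq> 0"
proof
  assume "S z = 0"
  have "[2 ^ m = g ^ (m * u)] (mod p\<^sup>2)"
    using cong_pow[OF u, of m] by (simp add: mult.commute flip: power_mult)
  then have "S (z ^ g ^ (m * u)) = S (z ^ 2 ^ m)"
    using power_cong_root[OF z] by metis
  then have "S (z ^ g ^ (p * f div 2)) = 0"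
    using S_cong[OF z m] S_zero_power_two[OF \<open>S z = 0\<close>] by simp
  then show False using S_half_turn[OF z \<open>z \<noteq> 1\<close>] \<open>S z = 0\<close> by simp
qed

lemma half_turn_multiple:
  assumes "f = 2 ^ r" and "\<not> f dvd u"
  shows "\<exists>m. [m * u = p * f div 2] (mod p * f)"
proof -
  have "u \<noteq> 0" using assms(2) by (auto intro: Nat.gr0I)
  then obtain w where w: "u = 2 ^ multiplicity 2 u * w" "\<not> 2 dvd w"
    using multiplicity_decompose'[of u 2] by auto
  define v where "v = multiplicity 2 u"
  have u: "u = 2 ^ v * w" using w by (simp add: v_def)
  have "v < r"
  proof (rule ccontr)
    assume "\<not> v < r"
    then have "(2::nat) ^ r dvd 2 ^ v * w" by (simp add: le_imp_power_dvd)
    then show False using assms u by simp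
  qed
  obtain w' where w': "w = 2 * w' + 1" using w(2) by (metis oddE)
  \<comment> \<open>The witness raises the 2-part of \<open>u\<close> to exactly
    \<open>f div 2\<close>; since \<open>w\<close> is odd, it contributes only one copy of that and
    multiples of \<open>p * f\<close>.\<close>
  have "p * 2 ^ (r - 1 - v) * u = p * (2 ^ (r - 1 - v + v) * w)"
    by (simp add: u power_add)
  also have "r - 1 - v + v = r - 1" using \<open>v < r\<close> by simp
  also have "p * (2 ^ (r - 1) * w) = p * 2 ^ (r - 1) + p * f * w'"
    using \<open>v < r\<close> by (cases r) (simp_all add: assms w' algebra_simps)
  also have "p * 2 ^ (r - 1) = p * f div 2"
    using \<open>v < r\<close> by (cases r) (simp_all add: assms)
  finally have "[p * 2 ^ (r - 1 - v) * u = p * f div 2] (mod p * f)"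
    by (simp add: cong_def)
  then show ?thesis by blast
qed

text \<open>By Fermat, 2 and \<open>2 ^ p\<close> agree as exponents of a \<open>p\<close>-th root
  of unity. The index \<open>p * u\<close> of \<open>2 ^ p\<close> is a multiple of
  \<open>p * f\<close>, so it leaves \<open>S\<close> invariant, and Frobenius fixes
  \<open>S z\<close>.\<close>

lemma S_prime_root_bit:
  assumes "z ^ p = 1" and u: "[2 = g ^ u] (mod p\<^sup>2)" and "f dvd u"
  shows "S z = 0 \<or> S z = 1"
proof -
  have z: "z ^ p\<^sup>2 = 1" using assms(1) by (simp add: power2_eq_square power_mult)
  have "\<not> p dvd 2" using p_ge_3 by (auto dest: dvd_imp_le)
  then have "[2 ^ (p - 1) * 2 = 1 * 2] (mod p)"
    by (intro cong_mult cong_refl fermat_theorem prime_p)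
  then have "[2 ^ p = 2] (mod p)"
    using p_ge_3 by (simp add: mult.commute flip: power_Suc)
  then have "z ^ 2 = z ^ 2 ^ p" by (intro power_cong_root[OF assms(1)]) (rule cong_sym)
  also have "\<dots> = z ^ g ^ (p * u)"
    using cong_pow[OF u, of p]
    by (intro power_cong_root[OF z]) (simp add: mult.commute flip: power_mult)
  finally have "(S z)\<^sup>2 = S (z ^ g ^ (p * u))" by (simp add: S_square)
  also have "\<dots> = S z"
    using \<open>f dvd u\<close> by (intro S_invariant[OF z]) (simp add: cong_0_iff)
  finally show ?thesis by (rule fixed_by_square_bit_closure)
qed

text \<open>If \<open>S\<close> vanishes at all conjugates \<open>z ^ (1 + p * t)\<close> of \<open>z\<close> over the \<open>p\<close>-th roots of unity,
  then a discrete Fourier transform in \<open>t\<close> isolates the exponents of each residue modulo \<open>p\<close>.\<close>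

lemma residue_part_zero:
  assumes z: "z ^ p\<^sup>2 = 1" and "z ^ p \<noteq> 1" and conj: "\<And>t. S (z ^ (1 + p * t)) = 0"
  shows "(\<Sum>x | x \<in> C \<and> [x = j] (mod p). z ^ x) = 0"
proof -
  \<comment> \<open>Here \<open>(p - 1) * j\<close> stands for \<open>-j\<close> modulo
    \<open>p\<close>: \<open>w x\<close> is a \<open>p\<close>-th root of unity, equal to 1 exactly
    when \<open>x\<close> is congruent to \<open>j\<close>.\<close>
  define w where "w x = z ^ (p * (x + (p - 1) * j))" for x
  have w_sum: "(\<Sum>t<p. w x ^ t) = of_bool [x = j] (mod p)" for x
  proof -
    have "w x ^ p = (z ^ p\<^sup>2) ^ (x + (p - 1) * j)"
      by (simp add: w_def power2_eq_square mult_ac flip: power_mult)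
    then have "w x ^ p = 1" using z by simp
    moreover have "w x = 1 \<longleftrightarrow> p dvd x + (p - 1) * j"
      unfolding w_def prime_square_order[OF prime_p z assms(2)]
      using p_ge_3 by (simp add: power2_eq_square)
    moreover have "p dvd x + (p - 1) * j \<longleftrightarrow> [x = j] (mod p)"
    proof -
      have "j + (p - 1) * j = p * j" using p_ge_3 by (cases p) auto
      then have "[j + (p - 1) * j = 0] (mod p)" by (simp only: cong_0_iff dvd_triv_left)
      then have "[x + (p - 1) * j = 0] (mod p) \<longleftrightarrow> [x + (p - 1) * j = j + (p - 1) * j] (mod p)"
        by (meson cong_sym cong_trans)
      then show ?thesis by (simp only: cong_0_iff cong_add_rcancel_nat)
    qed
    ultimately show ?thesis
      using odd_p by (simp add: sum_powers_root_of_unity of_nat_bit_closure)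
  qed
  \<comment> \<open>Twisting the vanishing values by a character in \<open>t\<close> and summing
    selects the class of \<open>j\<close>; the resulting factor \<open>p\<close> is 1 in
    characteristic 2.\<close>
  have "0 = (\<Sum>t<p. z ^ (p * ((p - 1) * j) * t) * S (z ^ (1 + p * t)))"
    by (simp add: conj del: One_nat_def)
  also have "\<dots> = (\<Sum>t<p. \<Sum>x\<in>C. z ^ x * w x ^ t)"
    unfolding S_def sum_distrib_left
    by (intro sum.cong refl) (simp add: w_def algebra_simps flip: power_mult power_add)
  also have "\<dots> = (\<Sum>x\<in>C. z ^ x * (\<Sum>t<p. w x ^ t))"
    by (subst sum.swap) (simp add: sum_distrib_left)
  also have "\<dots> = (\<Sum>x\<in>C. if [x = j] (mod p) then z ^ x else 0)"
    unfolding w_sum by (intro sum.cong refl) auto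
  also have "\<dots> = (\<Sum>x | x \<in> C \<and> [x = j] (mod p). z ^ x)"
    using finite_C by (simp add: sum.inter_filter)
  finally show ?thesis ..
qed

text \<open>\<open>g ^ q\<close> generates the residues congruent to 1 modulo \<open>p\<close> and moves each class
  to the one \<open>f\<close> places further.\<close>

definition q :: nat where "q = (p - 1) * (p - f)"

section \<open>The progression of exponents \<open>b + q * n\<close>\<close>

lemma f_less_p: "f < p"
  using ef e_pos p_ge_3 by (cases e) auto

text \<open>Expanding gives \<open>q + p * f = p * (p - 1) + f\<close>, where
  \<open>p * (p - 1) = p * f * e\<close>.\<close>

lemma q_cong: "[q = f] (mod p * f)"
proof -
  have "q + p * f = (p - 1) * p - (p - 1) * f + p * f"
    by (simp add: q_def diff_mult_distrib2)
  also have "\<dots> = (p - 1) * p + f"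
  proof -
    have "(p - 1) * f \<le> (p - 1) * p" using f_less_p by simp
    moreover have "p * f = (p - 1) * f + f" using p_ge_3 by (cases p) auto
    ultimately show ?thesis by linarith
  qed
  also have "\<dots> = f + p * f * e" unfolding pf_e by (simp add: mult.commute)
  finally have "[q + p * f = f + p * f * e] (mod p * f)" by simp
  then show ?thesis by (simp add: cong_def)
qed

text \<open>Modulo \<open>p * f\<close> a step of \<open>q\<close> is a step of \<open>f\<close>,
  and \<open>low\<close> counts from \<open>b\<close>. So the test becomes whether
  \<open>f * n\<close> lies below half of \<open>p * f\<close>.\<close>

lemma low_progression:
  assumes "n < p"
  shows "low (p * f) (b + q * n) \<longleftrightarrow> 2 * n < p"
proof -
  obtain h where h: "f = 2 * h" using even_f by auto
  have "h > 0" using f_pos h by simp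
  have "low (p * f) (b + q * n) \<longleftrightarrow> low (p * f) (b + f * n)"
    by (intro low_cong cong_add cong_mult cong_refl q_cong)
  also have "\<dots> \<longleftrightarrow> (f * n) mod (p * f) < p * f div 2"
  proof -
    have "(int (b + f * n) - int b) mod int (p * f) = int (f * n mod (p * f))"
      by (simp add: zmod_int)
    moreover have "int (p * f) div 2 = int (p * f div 2)" by (simp add: zdiv_int)
    ultimately show ?thesis unfolding low_def by (simp only: of_nat_less_iff)
  qed
  also have "(f * n) mod (p * f) = f * n" using assms f_pos by simp
  also have "f * n < p * f div 2 \<longleftrightarrow> h * (2 * n) < h * p"
    by (simp add: h mult_ac)
  also have "\<dots> \<longleftrightarrow> 2 * n < p" using \<open>h > 0\<close> by simp
  finally show ?thesis .
qed

lemma progression_inj: "inj_on (\<lambda>n. g ^ (b + q * n) mod p\<^sup>2) {..<p}"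
proof (rule inj_onI)
  fix m n assume *: "m \<in> {..<p}" "n \<in> {..<p}"
    and "g ^ (b + q * m) mod p\<^sup>2 = g ^ (b + q * n) mod p\<^sup>2"
  then have "[b + q * m = b + q * n] (mod p * (p - 1))" 
    unfolding cong_power_iff[symmetric] by (simp add: cong_def)
  then have "[q * m = q * n] (mod p * f)"
    unfolding pf_e[symmetric] cong_add_lcancel_nat by (rule cong_dvd_modulus_nat) simp
  moreover have "[q * i = f * i] (mod p * f)" for i
    by (intro cong_mult cong_refl q_cong)
  ultimately have "[f * m = f * n] (mod p * f)"
    by (meson cong_sym cong_trans)
  moreover have "f * m < p * f" "f * n < p * f" using * f_pos by auto
  ultimately show "m = n" using f_pos by (simp add: cong_def)
qed

text \<open>Modulo \<open>p * (p - 1)\<close> the exponent is \<open>b + (p - 1) * t\<close>; as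
  \<open>p - f\<close> is invertible modulo \<open>p\<close>, some \<open>n\<close> has
  \<open>(p - f) * n\<close> congruent to \<open>t\<close>.\<close>

lemma progression_cover:
  assumes "[m = b] (mod (p - 1))"
  shows "\<exists>n<p. [m = b + q * n] (mod p * (p - 1))"
proof -
  obtain t where t: "[m = b + (p - 1) * t] (mod (p - 1) * p)"
    using cong_lift_multiple[OF assms, of p] p_ge_3 by auto
  have "\<not> p dvd p - f"
    using f_less_p f_pos by (auto dest: dvd_imp_le)
  then have "coprime (p - f) p"
    using prime_p by (metis coprime_commute prime_imp_coprime_nat)
  then obtain n0 where n0: "[(p - f) * n0 = 1] (mod p)"
    using cong_solve_coprime_nat[OF \<open>coprime (p - f) p\<close>] by auto
  define n where "n = n0 * t mod p"
  have "[(p - f) * n = (p - f) * (n0 * t)] (mod p)"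
    unfolding n_def by (intro cong_mult cong_refl) (simp add: cong_def)
  also have "(p - f) * (n0 * t) = (p - f) * n0 * t" by simp
  also have "[(p - f) * n0 * t = 1 * t] (mod p)"
    by (rule cong_mult[OF n0 cong_refl])
  finally have "(p - f) * n mod p = t mod p" by (simp add: cong_def)
  then have "(p - 1) * ((p - f) * n) mod ((p - 1) * p) = (p - 1) * t mod ((p - 1) * p)"
    by (simp only: mod_mult_mult1)
  then have "[q * n = (p - 1) * t] (mod (p - 1) * p)"
    unfolding q_def cong_def by (simp only: mult.assoc)
  then have "[m = b + q * n] (mod (p - 1) * p)"
    using t by (meson cong_add cong_refl cong_sym cong_trans)
  moreover have "n < p" using p_ge_3 by (simp add: n_def)
  ultimately show ?thesis by (auto simp: mult.commute)
qed

text \<open>The units congruent to \<open>g ^ b\<close> modulo \<open>p\<close> are the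
  \<open>p\<close> terms of the progression. Starting it at \<open>b\<close> makes the members of
  \<open>C\<close> its initial half.\<close>

lemma residue_part_eq:
  "{x. x \<in> C \<and> [x = g ^ b] (mod p)} = (\<lambda>n. g ^ (b + q * n) mod p\<^sup>2) ` {n. n < p \<and> 2 * n < p}"
proof (rule subset_antisym; rule subsetI)
  fix x assume "x \<in> {x. x \<in> C \<and> [x = g ^ b] (mod p)}"
  then have x: "x \<in> C" "[x = g ^ b] (mod p)" by auto
  have "\<not> p dvd x"
    using not_p_dvd_power cong_dvd_iff[OF x(2)] by simp
  then have "x \<noteq> 0" "\<And>y. x \<noteq> p * y" by (intro notI; simp)+
  moreover have "x < p\<^sup>2" using x(1) C_less by auto
  ultimately obtain m where m: "x = g ^ m mod p\<^sup>2"
    by (metis residue_cases)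
  have "[g ^ m = x] (mod p\<^sup>2)" unfolding m by (simp add: cong_def)
  then have "[g ^ m = x] (mod p)" by (rule cong_dvd_modulus_nat) simp
  then have "[g ^ m = g ^ b] (mod p)" using x(2) by (rule cong_trans)
  then obtain n where n: "n < p" "[m = b + q * n] (mod p * (p - 1))"
    unfolding cong_power_prime_iff using progression_cover by blast
  then have "x = g ^ (b + q * n) mod p\<^sup>2"
    unfolding m using cong_power_iff by (simp add: cong_def)
  moreover from this have "2 * n < p"
    using x(1) power_mem_iff low_progression[OF n(1)] by simp
  ultimately show "x \<in> (\<lambda>n. g ^ (b + q * n) mod p\<^sup>2) ` {n. n < p \<and> 2 * n < p}"
    using n(1) by blast
next
  fix x assume "x \<in> (\<lambda>n. g ^ (b + q * n) mod p\<^sup>2) ` {n. n < p \<and> 2 * n < p}"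
  then obtain n where n: "n < p" "2 * n < p" "x = g ^ (b + q * n) mod p\<^sup>2" by blast
  have "[x = g ^ (b + q * n)] (mod p\<^sup>2)" unfolding n(3) by (simp add: cong_def)
  then have "[x = g ^ (b + q * n)] (mod p)" by (rule cong_dvd_modulus_nat) simp
  also have "[g ^ (b + q * n) = g ^ b] (mod p)"
    unfolding cong_power_prime_iff by (simp add: cong_def q_def mult.assoc)
  finally show "x \<in> {x. x \<in> C \<and> [x = g ^ b] (mod p)}"
    using n power_mem_iff low_progression by simp
qed

lemma progression_sum_zero:
  assumes z: "z ^ p\<^sup>2 = 1" and "z ^ p \<noteq> 1" and conj: "\<And>t. S (z ^ (1 + p * t)) = 0"
  shows "(\<Sum>n\<le>p div 2. z ^ g ^ (b + q * n)) = 0"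
proof -
  \<comment> \<open>For odd \<open>p\<close> this half has (p+1)/2 terms, one more than its
    complement.\<close>
  have set_eq: "{n. n < p \<and> 2 * n < p} = {..p div 2}"
    using odd_p by (auto elim!: oddE)
  have inj: "inj_on (\<lambda>n. g ^ (b + q * n) mod p\<^sup>2) {..p div 2}"
    by (rule inj_on_subset[OF progression_inj]) (use p_ge_3 in auto)
  have "0 = (\<Sum>x | x \<in> C \<and> [x = g ^ b] (mod p). z ^ x)"
    using residue_part_zero[OF assms] by simp
  also have "\<dots> = (\<Sum>n\<le>p div 2. z ^ (g ^ (b + q * n) mod p\<^sup>2))"
    unfolding residue_part_eq set_eq by (simp add: sum.reindex[OF inj])
  also have "\<dots> = (\<Sum>n\<le>p div 2. z ^ g ^ (b + q * n))"
    by (simp only: power_mod_root[OF z])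
  finally show ?thesis ..
qed

text \<open>With \<open>k'\<close> inverse to \<open>k\<close> modulo \<open>p\<close>, the power
  \<open>k' * t\<close> of \<open>2 ^ e\<close> is congruent to \<open>1 + p * t\<close> modulo
  \<open>p\<^sup>2\<close>. Frobenius then carries the zero along.\<close>

lemma S_zero_conjugates:
  assumes z: "z ^ p\<^sup>2 = 1" and "S z = 0"
    and k: "2 ^ e = 1 + p * k" "\<not> p dvd k"
  shows "S (z ^ (1 + p * t)) = 0"
proof -
  have "coprime k p" using k(2) prime_p by (metis coprime_commute prime_imp_coprime_nat)
  then obtain k' where k': "[k * k' = 1] (mod p)"
    using cong_solve_coprime_nat[OF \<open>coprime k p\<close>] by auto
  have "[(k * k') * t = 1 * t] (mod p)" by (rule cong_mult[OF k' cong_refl])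
  then have "p * (k * k' * t) mod (p * p) = p * t mod (p * p)"
    by (simp only: mod_mult_mult1 cong_def mult_1)
  then have "[p * (k * k' * t) = p * t] (mod p\<^sup>2)"
    unfolding power2_eq_square cong_def .
  then have "[1 + p * (k * k' * t) = 1 + p * t] (mod p\<^sup>2)"
    by (rule cong_add[OF cong_refl])
  moreover have "[(1 + p * k) ^ (k' * t) = 1 + p * k * (k' * t)] (mod p\<^sup>2)"
    by (rule power_one_plus_prime_mult)
  moreover have "p * k * (k' * t) = p * (k * k' * t)" by simp
  ultimately have "[2 ^ (e * (k' * t)) = 1 + p * t] (mod p\<^sup>2)"
    unfolding power_mult k(1) by (metis cong_trans)
  then have "z ^ 2 ^ (e * (k' * t)) = z ^ (1 + p * t)"
    by (rule power_cong_root[OF z])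
  then show ?thesis using S_zero_power_two[OF \<open>S z = 0\<close>] by metis
qed

text \<open>The index \<open>u * e\<close> of \<open>2 ^ e\<close> is divisible by
  \<open>f * e = p - 1\<close> but not by \<open>p * f * e\<close>, the order of \<open>g\<close>
  modulo \<open>p\<^sup>2\<close>.\<close>

lemma two_power_e:
  assumes u: "[2 = g ^ u] (mod p\<^sup>2)" and "f dvd u" and "\<not> p * f dvd u"
  shows "\<exists>k. 2 ^ e = 1 + p * k \<and> \<not> p dvd k"
proof -
  have u': "[2 ^ e = g ^ (u * e)] (mod p\<^sup>2)"
    using cong_pow[OF u, of e] by (simp flip: power_mult)
  then have "[2 ^ e = g ^ (u * e)] (mod p)" by (rule cong_dvd_modulus_nat) simp
  also have "[g ^ (u * e) = g ^ 0] (mod p)"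
  proof -
    have "e * f dvd u * e" using \<open>f dvd u\<close> by (simp add: mult.commute)
    then show ?thesis unfolding cong_power_prime_iff cong_0_iff by (simp add: ef)
  qed
  finally have "[2 ^ e = 1] (mod p)" by simp
  then obtain k where "2 ^ e - 1 = p * k" by (metis cong_to_1_nat dvdE)
  then have k: "2 ^ e = 1 + p * k" by (metis le_add_diff_inverse one_le_power one_le_numeral)
  have "\<not> p dvd k"
  proof
    assume "p dvd k"
    then obtain l where "k = p * l" by blast
    then have "1 + p * k = 1 + l * p\<^sup>2" by (simp add: power2_eq_square)
    then have "[1 + p * k = 1] (mod p\<^sup>2)"
      by (simp only: cong_def mod_mult_self1)
    then have "[g ^ (u * e) = g ^ 0] (mod p\<^sup>2)"
      using u' unfolding k by (simp add: cong_def)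
    then have "p * f * e dvd u * e" unfolding cong_power_iff cong_0_iff pf_e .
    then show False using assms(3) e_pos by simp
  qed
  with k show ?thesis by blast
qed

lemma S_nonzero_primitive:
  assumes z: "z ^ p\<^sup>2 = 1" and zp: "z ^ p \<noteq> 1"
    and u: "[2 = g ^ u] (mod p\<^sup>2)" and fu: "f dvd u" and pfu: "\<not> p * f dvd u"
  shows "S z \<noteq> 0"
proof
  assume "S z = 0"
  obtain k where k: "2 ^ e = 1 + p * k" "\<not> p dvd k"
    using two_power_e[OF u fu pfu] by blast
  define z' where "z' = z ^ g ^ q"
  have z': "z' ^ p\<^sup>2 = 1"
  proof -
    have "z' ^ p\<^sup>2 = (z ^ p\<^sup>2) ^ g ^ q" by (simp add: z'_def mult.commute flip: power_mult)
    then show ?thesis using z by simp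
  qed
  have zp': "z' ^ p \<noteq> 1"
  proof
    assume "z' ^ p = 1"
    then have "z ^ (g ^ q * p) = 1" by (simp add: z'_def power_mult)
    then have "p\<^sup>2 dvd g ^ q * p" using prime_square_order[OF prime_p z zp] by blast
    then show False using not_p_dvd_power p_ge_3 by (simp add: power2_eq_square)
  qed
  \<comment> \<open>With \<open>u = f * v\<close> and \<open>m\<close> inverse to \<open>v\<close>
    modulo \<open>p\<close>, the index \<open>u * m\<close> of \<open>2 ^ m\<close> is congruent to
    \<open>f\<close>, hence to \<open>q\<close>, modulo \<open>p * f\<close>.\<close>
  have "S z' = 0"
  proof -
    obtain v where v: "u = f * v" using fu by auto
    have "\<not> p dvd v" using pfu v by (simp add: mult.commute)
    then have "coprime v p" using prime_p by (metis coprime_commute prime_imp_coprime_nat)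
    then obtain m where "[v * m = 1] (mod p)"
      using cong_solve_coprime_nat[OF \<open>coprime v p\<close>] by auto
    then have "f * (v * m) mod (f * p) = f * 1 mod (f * p)"
      by (simp only: mod_mult_mult1 cong_def)
    then have "[u * m = f] (mod p * f)"
      by (simp add: cong_def v mult_ac)
    then have um: "[u * m = q] (mod p * f)" using q_cong by (meson cong_sym cong_trans)
    have "[2 ^ m = g ^ (u * m)] (mod p\<^sup>2)"
      using cong_pow[OF u, of m] by (simp flip: power_mult)
    then have "z ^ 2 ^ m = z ^ g ^ (u * m)" by (rule power_cong_root[OF z])
    then have "S (z ^ g ^ (u * m)) = 0" using S_zero_power_two[OF \<open>S z = 0\<close>, of m] by simp
    then show ?thesis unfolding z'_def using S_cong[OF z um] by simp
  qed
  define F where "F n = z ^ g ^ (b + q * n)" for n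
  have "(\<Sum>n<Suc (p div 2). F n) = 0"
    using progression_sum_zero[OF z zp S_zero_conjugates[OF z \<open>S z = 0\<close> k]]
    unfolding F_def lessThan_Suc_atMost .
  moreover have "z' ^ g ^ (b + q * n) = F (Suc n)" for n
    by (simp add: z'_def F_def ac_simps flip: power_mult power_add)
  then have "(\<Sum>n<Suc (p div 2). F (Suc n)) = 0"
    using progression_sum_zero[OF z' zp' S_zero_conjugates[OF z' \<open>S z' = 0\<close> k]]
    by (simp only: lessThan_Suc_atMost)
  \<comment> \<open>The two vanishing sums are windows of \<open>F\<close> shifted by one, so they
    differ only in their outer terms.\<close>
  ultimately have "F 0 = F (Suc (p div 2))"
    unfolding sum.lessThan_Suc_shift[of F "p div 2"] 
    unfolding sum.lessThan_Suc[of "\<lambda>n. F (Suc n)" "p div 2"]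
    by (metis add_right_cancel add.commute)
  then have "[g ^ (b + q * 0) = g ^ (b + q * Suc (p div 2))] (mod p\<^sup>2)"
    unfolding F_def using power_eq_iff_cong[OF prime_square_order[OF prime_p z zp]] p_ge_3 by simp
  then have "g ^ (b + q * 0) mod p\<^sup>2 = g ^ (b + q * Suc (p div 2)) mod p\<^sup>2"
    unfolding cong_def .
  \<comment> \<open>Both outer indices lie in the range on which the progression is
    injective.\<close>
  moreover have "Suc (p div 2) < p" using p_ge_3 by presburger
  ultimately have "0 = Suc (p div 2)"
    using inj_onD[OF progression_inj, of 0 "Suc (p div 2)"] by auto
  then show False by simp
qed

section \<open>Counting the zeros\<close>

lemma two_power_ex: "\<exists>u. [2 = g ^ u] (mod p\<^sup>2)"
  using cong_power_ex[of 2] odd_p by simp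

lemma two_mem_class_iff:
  assumes u: "[2 = g ^ u] (mod p\<^sup>2)"
  shows "2 \<in> gen_cyc_class p e f g 1 0 \<longleftrightarrow> f dvd u"
proof -
  have "[2 = g ^ u] (mod p)" using u by (rule cong_dvd_modulus_nat) simp
  then have "2 = g ^ u mod p" using p_ge_3 by (simp add: cong_def)
  then show ?thesis using class_1_mem_iff[of u 0] by (simp add: cong_0_iff)
qed

lemma dft_gen_cyc_seq:
  "dft (p\<^sup>2) \<alpha> (\<lambda>n. to_ac (gen_cyc_seq p e f g b n)) a = S (\<alpha> ^ a)"
proof -
  have "dft (p\<^sup>2) \<alpha> (\<lambda>n. to_ac (gen_cyc_seq p e f g b n)) a
      = (\<Sum>n<p\<^sup>2. if n \<in> C then \<alpha> ^ (a * n) else 0)"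
    unfolding dft_def by (intro sum.cong refl) (simp add: gen_cyc_seq_def)
  also have "\<dots> = (\<Sum>n\<in>{..<p\<^sup>2} \<inter> C. \<alpha> ^ (a * n))"
    by (simp add: sum.inter_restrict)
  also have "{..<p\<^sup>2} \<inter> C = C" using C_less by blast
  finally show ?thesis by (simp add: S_def power_mult)
qed

lemma linear_complexity_eq:
  assumes prim: "\<And>n. \<alpha> ^ n = 1 \<longleftrightarrow> p\<^sup>2 dvd n"
  shows "linear_complexity (gen_cyc_seq p e f g b) = p\<^sup>2 - card {a. a < p\<^sup>2 \<and> S (\<alpha> ^ a) = 0}"
proof -
  have "linear_complexity (gen_cyc_seq p e f g b) = card {a. a < p\<^sup>2 \<and> S (\<alpha> ^ a) \<noteq> 0}"
    using linear_complexity_eq_card_dft_support[of "gen_cyc_seq p e f g b" "p\<^sup>2" \<alpha>, OF _ _ prim] odd_p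
    unfolding dft_gen_cyc_seq by (simp add: gen_cyc_seq_def)
  also have "{a. a < p\<^sup>2 \<and> S (\<alpha> ^ a) \<noteq> 0} = {..<p\<^sup>2} - {a. a < p\<^sup>2 \<and> S (\<alpha> ^ a) = 0}" by auto
  also have "card \<dots> = p\<^sup>2 - card {a. a < p\<^sup>2 \<and> S (\<alpha> ^ a) = 0}"
    by (subst card_Diff_subset) auto
  finally show ?thesis .
qed

text \<open>\<open>M\<close> holds the exponents of the \<open>p\<close>-th roots of unity other
  than 1. All zeros lie there, \<open>S\<close> takes only the values 0 and 1 there, and
  \<open>\<phi>\<close> injects the zeros into the ones and the ones into the zeros.\<close>

lemma card_zeros:
  assumes prim: "\<And>n. \<alpha> ^ n = 1 \<longleftrightarrow> p\<^sup>2 dvd n"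
    and u: "[2 = g ^ u] (mod p\<^sup>2)" and fu: "f dvd u" and pfu: "\<not> p * f dvd u"
  shows "card {a. a < p\<^sup>2 \<and> S (\<alpha> ^ a) = 0} = (p - 1) div 2"
proof -
  define M where "M = (*) p ` {1..<p}"
  define Z where "Z = {a. a < p\<^sup>2 \<and> S (\<alpha> ^ a) = 0}"
  define \<phi> where "\<phi> = (\<lambda>a. g ^ (p * f div 2) * a mod p\<^sup>2)"
  have root: "(\<alpha> ^ a) ^ p\<^sup>2 = 1" for a
    unfolding power_mult[symmetric] prim by simp
  have M_iff: "a \<in> M \<longleftrightarrow> a < p\<^sup>2 \<and> p dvd a \<and> a \<noteq> 0" for a
    using p_ge_3 by (auto simp: M_def power2_eq_square elim!: dvdE)
  have "Z \<subseteq> M"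
  proof
    fix a assume "a \<in> Z"
    then have a: "a < p\<^sup>2" "S (\<alpha> ^ a) = 0" by (auto simp: Z_def)
    then have "(\<alpha> ^ a) ^ p = 1" using S_nonzero_primitive[OF root _ u fu pfu] by blast
    then have "p\<^sup>2 dvd a * p" by (simp add: prim flip: power_mult)
    then have "p dvd a" using p_ge_3 by (simp add: power2_eq_square)
    moreover have "a \<noteq> 0" using a(2) S_one by (intro notI) simp
    ultimately show "a \<in> M" using M_iff a(1) by blast
  qed
  have bit: "S (\<alpha> ^ a) = 0 \<or> S (\<alpha> ^ a) = 1" if "a \<in> M" for a
  proof (rule S_prime_root_bit[OF _ u fu])
    have "p\<^sup>2 dvd a * p" using that M_iff by (simp add: power2_eq_square)
    then show "(\<alpha> ^ a) ^ p = 1" by (simp add: prim flip: power_mult)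
  qed
  have \<phi>M: "\<phi> a \<in> M" if aM: "a \<in> M" for a
  proof -
    obtain c where c: "a = p * c" "c \<in> {1..<p}" using aM unfolding M_def by blast
    then have "\<not> p dvd c" using c(2) by (auto dest: dvd_imp_le)
    then have "\<not> p dvd g ^ (p * f div 2) * c"
      using not_p_dvd_power prime_dvd_mult_iff[OF prime_p] by blast
    moreover have "\<phi> a = p * (g ^ (p * f div 2) * c mod p)"
      unfolding \<phi>_def c(1) power2_eq_square by (simp only: mult.left_commute[of _ p] mod_mult_mult1)
    ultimately show ?thesis
      unfolding M_def using p_ge_3 by (auto simp: dvd_eq_mod_eq_0)
  qed
  have swap: "S (\<alpha> ^ a) + S (\<alpha> ^ \<phi> a) = 1" if "a \<in> M" for a
  proof -
    have "\<not> p\<^sup>2 dvd a" using that M_iff[of a] nat_dvd_not_less[of a "p\<^sup>2"] by simp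
    then have "\<alpha> ^ a \<noteq> 1" by (simp only: prim not_False_eq_True)
    moreover have "\<alpha> ^ p\<^sup>2 = 1" unfolding prim by simp
    then have "\<alpha> ^ \<phi> a = (\<alpha> ^ a) ^ g ^ (p * f div 2)"
      unfolding \<phi>_def by (simp only: power_mod_root mult.commute[of _ a] power_mult)
    ultimately show ?thesis using S_half_turn[OF root] by simp
  qed
  have inj: "inj_on \<phi> A" if "A \<subseteq> M" for A
  proof (rule inj_on_subset)
    show "inj_on \<phi> {..<p\<^sup>2}"
      unfolding \<phi>_def using bij_mult_power by (rule bij_betw_imp_inj_on)
    show "A \<subseteq> {..<p\<^sup>2}" using that M_iff by blast
  qed
  have finM: "finite M" by (simp add: M_def)
  have "\<phi> ` Z \<subseteq> M - Z"
  proof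
    fix y assume "y \<in> \<phi> ` Z"
    then obtain a where a: "a \<in> Z" "y = \<phi> a" by blast
    then have "a \<in> M" "S (\<alpha> ^ a) = 0" using \<open>Z \<subseteq> M\<close> by (auto simp: Z_def)
    then show "y \<in> M - Z" using swap[of a] \<phi>M[of a] a(2) by (simp add: Z_def)
  qed
  then have "card Z \<le> card (M - Z)"
    using inj[OF \<open>Z \<subseteq> M\<close>] finM by (intro card_inj_on_le) auto
  moreover have "\<phi> ` (M - Z) \<subseteq> Z"
  proof
    fix y assume "y \<in> \<phi> ` (M - Z)"
    then obtain a where a: "a \<in> M" "a \<notin> Z" "y = \<phi> a" by blast
    then have "S (\<alpha> ^ a) = 1" using bit[of a] M_iff[of a] by (auto simp: Z_def)
    then have "S (\<alpha> ^ y) = 0" using swap[OF a(1)] a(3) by simp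
    then show "y \<in> Z" using \<phi>M[OF a(1)] M_iff[of y] a(3) by (simp add: Z_def)
  qed
  then have "card (M - Z) \<le> card Z"
    using inj[of "M - Z"] finite_subset[OF \<open>Z \<subseteq> M\<close> finM] by (intro card_inj_on_le) auto
  ultimately have "card (M - Z) = card Z" by simp
  moreover have "card (M - Z) = card M - card Z"
    using \<open>Z \<subseteq> M\<close> finM finite_subset by (intro card_Diff_subset) auto
  moreover have "card Z \<le> card M" by (rule card_mono[OF finM \<open>Z \<subseteq> M\<close>])
  moreover have "card M = p - 1"
    unfolding M_def using p_ge_3 by (subst card_image) (auto intro: inj_onI)
  ultimately have "p - 1 = 2 * card Z" by linarith
  then show ?thesis by (simp add: Z_def)
qed

end

theorem theorem1:
  fixes p e f r g b :: nat
  assumes "prime p" and "odd p"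
    and "e dvd p - 1"
    and "f = (p - 1) div e"
    and "f = 2 ^ r" and "r \<ge> 1"
    and "residue_primroot (p\<^sup>2) g"
    and "b \<le> p * f - 1"
    and "\<not> [2 ^ e = 1] (mod p\<^sup>2)"
  shows "linear_complexity (gen_cyc_seq p e f g b) =
    (if 2 \<in> gen_cyc_class p e f g 1 0 then p\<^sup>2 - (p - 1) div 2 else p\<^sup>2)"
proof -
  interpret gen_cyclotomic p e f g b
  proof
    show "e * f = p - 1" using assms(3,4) by simp
    show "even f" using assms(5,6) by simp
  qed (use assms in auto)
  obtain \<alpha> :: "bit alg_closure" where prim: "\<And>n. \<alpha> ^ n = 1 \<longleftrightarrow> p\<^sup>2 dvd n"
    using primitive_prime_square_root_exists[OF assms(1,2)] by blast
  obtain u where u: "[2 = g ^ u] (mod p\<^sup>2)" using two_power_ex by blast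
  show ?thesis
  proof (cases "f dvd u")
    case True
    \<comment> \<open>Otherwise \<open>2 ^ e\<close> would have an index divisible by the order
      \<open>p * f * e\<close> of \<open>g\<close>, against the hypothesis on
      \<open>2 ^ e\<close>.\<close>
    have "\<not> p * f dvd u"
    proof
      assume "p * f dvd u"
      then have "[g ^ (u * e) = g ^ 0] (mod p\<^sup>2)"
        unfolding cong_power_iff cong_0_iff pf_e[symmetric] by (rule mult_dvd_mono) simp
      moreover have "[2 ^ e = g ^ (u * e)] (mod p\<^sup>2)"
        using cong_pow[OF u, of e] by (simp flip: power_mult)
      ultimately show False using assms(9) cong_trans by (simp add: cong_def)
    qed
    then show ?thesis
      using card_zeros[OF prim u True] linear_complexity_eq[OF prim] two_mem_class_iff[OF u] True
      by simp
  next
    case False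
    obtain m where m: "[m * u = p * f div 2] (mod p * f)"
      using half_turn_multiple[OF assms(5) False] by blast
    have "S (\<alpha> ^ a) \<noteq> 0" for a
    \<comment> \<open>The half-turn identity needs an argument other than 1; at 1 the parity of
      \<open>card C\<close> decides.\<close>
    proof (cases "\<alpha> ^ a = 1")
      case False
      have "(\<alpha> ^ a) ^ p\<^sup>2 = 1" unfolding power_mult[symmetric] prim by simp
      then show ?thesis using False u m by (rule S_nonzero_half_turn)
    qed (simp add: S_one)
    then show ?thesis
      using linear_complexity_eq[OF prim] two_mem_class_iff[OF u] False by simp
  qed
qed

end
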